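(* Let $n\ge 1$, let $\lambda=(\lambda_1,\ldots,\lambda_n)\in\mathrm{Part}(\binom n2;n)$, and let $p\in\{1,\ldots,n\}$ be arbitrary. Then $$\mathrm{mult}_{\mathbf{S}}(\mu[\lambda])=N_\lambda=\sum_{\beta\in M_p(\lambda)}N_{\lambda-\beta}=\sum_{\beta\in M_p(\lambda)}\mathrm{mult}_{\mathbf S}(\mu[\lambda-\beta]),$$ where in the last sum $\mathbf{S}$ denotes the spin module attached to the Cartan subalgebra of $\mathfrak{sl}(n-1,\mathbb C)$.
   Context: Let $\mathfrak{g}=\mathfrak{sl}(n,\mathbb{C})$, $\mathfrak{t}$ the Cartan subalgebra of diagonal matrices, $\epsilon_i\in\mathfrak{t}^*$ the functional $\mathrm{diag}(t_1,\ldots,t_n)\mapsto t_i$, $\Phi^+=\{\epsilon_i-\epsilon_j:1\le i<j\le n\}$, and $\varpi_i=\epsilon_1+\cdots+\epsilon_i$ for $1\le i\le n-1$ the fundamental weights. Here the Levi subalgebra is $\mathfrak{h}=\mathfrak{t}$, and the spin module is $\mathbf{S}=\bigwedge\mathfrak{u}^+$ with $\mathfrak{u}^+=\bigoplus_{\alpha\in\Phi^+}\mathfrak{g}_\alpha$, on which $\mathfrak{t}$ acts through $\mathfrak{t}\xrightarrow{\mathrm{ad}}\mathfrak{so}(\mathfrak q)\subset\mathbf C(\mathfrak q)\to\mathrm{End}(\mathbf S)$ (Clifford multiplication), $\mathfrak q$ being the orthogonal complement of $\mathfrak t$ for the Killing form. Its weights are $\mu(A)=\frac12\big(\sum_{\alpha\in\Phi^+\setminus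 A}\alpha-\sum_{\alpha\in A}\alpha\big)$, $A\subset\Phi^+$, and $\mathrm{mult}_{\mathbf S}(\mu)=\#\{A\subset\Phi^+:\mu(A)=\mu\}$ for $\mu\in\mathfrak t^*$. $\mathrm{Part}(\binom n2;n)$ is the set of partitions of $\binom n2$ with at most $n$ parts, i.e. sequences of nonnegative integers $\lambda_1\ge\cdots\ge\lambda_n$ with $\lambda_1+\cdots+\lambda_n=\binom n2$. For such $\lambda$, put $\mu[\lambda]=(\lambda_1-\lambda_2)\varpi_1+\cdots+(\lambda_{n-1}-\lambda_n)\varpi_{n-1}$ and $N_\lambda=\mathrm{mult}_{\mathbf S}(\mu[\lambda])$. View $\lambda$ as a Young diagram with rows of lengths $\lambda_1,\ldots,\lambda_n$. A $p$-marking of $\lambda$ is a subset of boxes $\beta\subset\lambda$ such that: $\beta$ contains exactly $n-1$ boxes; $\beta$ contains all the boxes of the $p$-th row of $\lambda$; in each of the other rows, only the rightmost box may belong to $\beta$. $M_p(\lambda)$ is the set of $p$-markings. For $\beta\in M_p(\lambda)$, $\lambda-\beta\in\mathrm{Part}(\binom{n-1}2;n-1)$ is the partition obtained by arranging in nonincreasing order the lengths of the rows of $\lambda\setminus\beta$ (the $p$-th row, now empty, being omitted); $N_{\lambda-\beta}$ is the corresponding multiplicity for $\mathfrak{sl}(n-1,\mathbb C)$. In the degenerate case $n-1=0$, $N$ of the empty partition is $1$. *)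

theory Defs
  imports "Jordan_Normal_Form.Matrix" "HOL-Library.Function_Algebras"
begin

(* All indices are 0-based: matrix entries, rows and boxes of diagrams, parts of partitions. *)

definition mtrace :: "complex mat \<Rightarrow> complex" where
  "mtrace X = (\<Sum>i<dim_row X. X $$ (i, i))"

definition sl :: "nat \<Rightarrow> complex mat set" where
  "sl n = {X \<in> carrier_mat n n. mtrace X = 0}"

definition cartan :: "nat \<Rightarrow> complex mat set" where
  "cartan n = {H \<in> sl n. diagonal_mat H}"

definition ad :: "complex mat \<Rightarrow> complex mat \<Rightarrow> complex mat" where
  "ad X Y = X * Y - Y * X"

definition unit_E :: "nat \<Rightarrow> nat \<times> nat \<Rightarrow> complex mat" where
  "unit_E n a = mat n n (\<lambda>b. if b = a then 1 else 0)"

(* The trace of ad X ad Y on sl(n), computed in the basis of sl(n) consisting of the E_ij with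
   i \<noteq> j and the E_ii - E_(n-1)(n-1) with i < n - 1; the coordinates of a traceless matrix Z in
   this basis are the entries Z_ij and Z_ii. *)
definition killing :: "nat \<Rightarrow> complex mat \<Rightarrow> complex mat \<Rightarrow> complex" where
  "killing n X Y =
     (\<Sum>a\<in>{(i, j). i < n \<and> j < n \<and> i \<noteq> j}. ad X (ad Y (unit_E n a)) $$ a) +
     (\<Sum>i<n - 1. ad X (ad Y (unit_E n (i, i) - unit_E n (n - 1, n - 1))) $$ (i, i))"

(* The pair (i, j) stands for the positive root eps i - eps j, whose root space is spanned
   by E_ij.  So u^+ consists of the strictly upper triangular matrices. *)
definition pos_roots :: "nat \<Rightarrow> (nat \<times> nat) set" where
  "pos_roots n = {(i, j). i < j \<and> j < n}"

(* Functionals on the Cartan subalgebra are functions on matrices, of which only the values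
   on cartan n matter. *)
definition eps :: "nat \<Rightarrow> complex mat \<Rightarrow> complex" where
  "eps i H = H $$ (i, i)"

definition fund_weight :: "nat \<Rightarrow> complex mat \<Rightarrow> complex" where
  "fund_weight k H = (\<Sum>i<k. eps i H)"

(* The exterior algebra of u^+: the function f stands for the sum of the f A e_A over the sets A
   of positive roots, where e_A is the exterior product of the root vectors E_a, a \<in> A,
   in lexicographic order. *)
type_synonym spinor = "(nat \<times> nat) set \<Rightarrow> complex"

definition spin_space :: "nat \<Rightarrow> spinor set" where
  "spin_space n = {f. \<forall>A. \<not> A \<subseteq> pos_roots n \<longrightarrow> f A = 0}"

definition spin_scale :: "complex \<Rightarrow> spinor \<Rightarrow> spinor" where
  "spin_scale c f = (\<lambda>A. c * f A)"

definition koszul_sign :: "nat \<times> nat \<Rightarrow> (nat \<times> nat) set \<Rightarrow> complex" where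
  "koszul_sign a A =
     (- 1) ^ card {b \<in> A. fst b < fst a \<or> (fst b = fst a \<and> snd b < snd a)}"

(* wedge a is left exterior multiplication by E_a, and contract a is the antiderivation
   that sends E_a to 1 and the other root vectors in u^+ to 0. *)
definition wedge :: "nat \<times> nat \<Rightarrow> spinor \<Rightarrow> spinor" where
  "wedge a f = (\<lambda>A. if a \<in> A then koszul_sign a A * f (A - {a}) else 0)"

definition contract :: "nat \<times> nat \<Rightarrow> spinor \<Rightarrow> spinor" where
  "contract a f = (\<lambda>A. if a \<in> A then 0 else koszul_sign a A * f (insert a A))"

(* Clifford multiplication by x in q = u^+ + u^-, the Killing-orthogonal complement of the Cartan
   subalgebra (the matrices with zero diagonal).  Its u^+ component acts by exterior
   multiplication and its u^- component y by twice the contraction with killing n y; the u^+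
   component is killing-orthogonal to u^+, so killing n x may be used for killing n y.  The
   square of clifford n x is the scalar killing n x x. *)
definition clifford :: "nat \<Rightarrow> complex mat \<Rightarrow> spinor \<Rightarrow> spinor" where
  "clifford n x f = (\<lambda>A. \<Sum>a\<in>pos_roots n.
     x $$ a * wedge a f A + 2 * killing n x (unit_E n a) * contract a f A)"

(* The embedding of so(q) into the Clifford algebra with relations v w + w v = 2 killing n v w,
   followed by Clifford multiplication: T goes to 1/4 times the sum of the T(b_k) b^k, where
   (b_k) is any basis of q and (b^k) its dual basis for the Killing form.  It is characterised,
   up to scalars, by [spin_lift n T, clifford n v] = clifford n (T v) for v in q.  Here (b_k) is
   the basis of the E_ij, and the dual basis vector of E_ij is a multiple of E_ji. *)
definition spin_lift :: "nat \<Rightarrow> (complex mat \<Rightarrow> complex mat) \<Rightarrow> spinor \<Rightarrow> spinor" where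
  "spin_lift n T f = (\<lambda>A. 1 / 4 * (\<Sum>(i, j)\<in>{(i, j). i < n \<and> j < n \<and> i \<noteq> j}.
     clifford n (T (unit_E n (i, j)))
       (clifford n ((1 / killing n (unit_E n (i, j)) (unit_E n (j, i))) \<cdot>\<^sub>m unit_E n (j, i)) f) A))"

definition spin_weight_space :: "nat \<Rightarrow> (complex mat \<Rightarrow> complex) \<Rightarrow> spinor set" where
  "spin_weight_space n \<mu> =
     {f \<in> spin_space n. \<forall>H\<in>cartan n. spin_lift n (ad H) f = spin_scale (\<mu> H) f}"

lemma vector_space_spin_scale: "vector_space spin_scale"
  by unfold_locales (auto simp: spin_scale_def fun_eq_iff algebra_simps)

definition spin_mult :: "nat \<Rightarrow> (complex mat \<Rightarrow> complex) \<Rightarrow> nat" where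
  "spin_mult n \<mu> = vector_space.dim spin_scale (spin_weight_space n \<mu>)"

definition Part :: "nat \<Rightarrow> nat \<Rightarrow> nat list set" where
  "Part m n = {lam. length lam = n \<and> sorted_wrt (\<ge>) lam \<and> sum_list lam = m}"

definition part_weight :: "nat \<Rightarrow> nat list \<Rightarrow> complex mat \<Rightarrow> complex" where
  "part_weight n lam H =
     (\<Sum>k\<in>{1..<n}. (of_nat (lam ! (k - 1)) - of_nat (lam ! k)) * fund_weight k H)"

(* For n = 0 this is 1, since spin_space 0 is one-dimensional and cartan 0 acts on it by zero. *)
definition N :: "nat \<Rightarrow> nat list \<Rightarrow> nat" where
  "N n lam = spin_mult n (part_weight n lam)"

definition diagram :: "nat list \<Rightarrow> (nat \<times> nat) set" where
  "diagram lam = {(i, j). i < length lam \<and> j < lam ! i}"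

definition markings :: "nat \<Rightarrow> nat \<Rightarrow> nat list \<Rightarrow> (nat \<times> nat) set set" where
  "markings n p lam = {\<beta>. \<beta> \<subseteq> diagram lam \<and> card \<beta> = n - 1 \<and>
     (\<forall>j. (p, j) \<in> diagram lam \<longrightarrow> (p, j) \<in> \<beta>) \<and>
     (\<forall>(i, j)\<in>\<beta>. i \<noteq> p \<longrightarrow> j = lam ! i - 1)}"

definition remove_marking :: "nat \<Rightarrow> nat list \<Rightarrow> (nat \<times> nat) set \<Rightarrow> nat list" where
  "remove_marking p lam \<beta> =
     rev (sort (map (\<lambda>i. card {j. (i, j) \<in> diagram lam - \<beta>})
                    (filter (\<lambda>i. i \<noteq> p) [0..<length lam])))"

end

theory Submission
  imports Defs "HOL-Combinatorics.List_Permutation"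
begin

text \<open>The torus acts diagonally on the basis \<open>e_A\<close> of \<open>S\<close>.  Reading \<open>A\<close> as the tournament on the
  vertices \<open>0, \<dots>, n - 1\<close> in which, for \<open>i < j\<close>, the vertex \<open>i\<close> beats \<open>j\<close> iff \<open>(i, j) \<in> A\<close>, the
  weight of \<open>e_A\<close> is the sum of the \<open>eps i\<close> weighted by the scores.  Since the scores and the parts
  of \<open>\<lambda>\<close> have the same sum, \<open>N_\<lambda>\<close> is the number of tournaments with score sequence \<open>\<lambda>\<close>.
  Deleting the vertex \<open>p\<close> from such a tournament lowers by one the scores of the \<open>n - 1 - \<lambda>_p\<close>
  vertices that beat it: these are the rows other than \<open>p\<close> that lose a box in a \<open>p\<close>-marking.
  The number of tournaments does not depend on the order of the scores, so the remaining rows may be sorted.\<close>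

section \<open>The Killing form and Clifford multiplication\<close>

lemma unit_E_carrier [simp]: "unit_E n a \<in> carrier_mat n n"
  by (simp add: unit_E_def)

lemma unit_E_index [simp]: "i < n \<Longrightarrow> j < n \<Longrightarrow> unit_E n a $$ (i, j) = (if (i, j) = a then 1 else 0)"
  by (simp add: unit_E_def)

lemma smult_unit_E_index [simp]:
  "i < n \<Longrightarrow> j < n \<Longrightarrow> (c \<cdot>\<^sub>m unit_E n a) $$ (i, j) = (if (i, j) = a then c else 0)"
  by (simp add: unit_E_def)

lemma ad_carrier [simp]: "X \<in> carrier_mat n n \<Longrightarrow> Y \<in> carrier_mat n n \<Longrightarrow> ad X Y \<in> carrier_mat n n"
  unfolding ad_def by (intro minus_carrier_mat mult_carrier_mat)

lemma ad_index:
  assumes "X \<in> carrier_mat n n" "Y \<in> carrier_mat n n" "i < n" "j < n"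
  shows "ad X Y $$ (i, j) = (\<Sum>k<n. X $$ (i, k) * Y $$ (k, j)) - (\<Sum>k<n. Y $$ (i, k) * X $$ (k, j))"
  using assms by (simp add: ad_def scalar_prod_def atLeast0LessThan)

lemma ad_minus:
  assumes "X \<in> carrier_mat n n" "Y \<in> carrier_mat n n" "Z \<in> carrier_mat n n"
  shows "ad X (Y - Z) = ad X Y - ad X Z"
proof (rule eq_matI)
  fix i j assume "i < dim_row (ad X Y - ad X Z)" "j < dim_col (ad X Y - ad X Z)"
  moreover from assms have "ad X Z \<in> carrier_mat n n" by simp
  ultimately have ij: "i < n" "j < n" by auto
  have "ad X (Y - Z) $$ (i, j) = ad X Y $$ (i, j) - ad X Z $$ (i, j)"
    using assms ij by (simp add: ad_index[where n = n] minus_carrier_mat algebra_simps sum_subtractf)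
  also have "\<dots> = (ad X Y - ad X Z) $$ (i, j)"
    using ij \<open>ad X Z \<in> carrier_mat n n\<close> by simp
  finally show "ad X (Y - Z) $$ (i, j) = (ad X Y - ad X Z) $$ (i, j)" .
qed (use assms in \<open>auto simp: ad_def\<close>)

lemma ad_unit_E_index:
  assumes "Y \<in> carrier_mat n n" "k < n" "l < n" "i < n" "j < n"
  shows "ad Y (unit_E n (k, l)) $$ (i, j) =
    (if j = l then Y $$ (i, k) else 0) - (if i = k then Y $$ (l, j) else 0)"
proof -
  have "(\<Sum>m<n. Y $$ (i, m) * unit_E n (k, l) $$ (m, j)) =
      (\<Sum>m<n. if m = k then (if j = l then Y $$ (i, m) else 0) else 0)"
    using assms by (intro sum.cong) auto
  moreover have "(\<Sum>m<n. unit_E n (k, l) $$ (i, m) * Y $$ (m, j)) =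
      (\<Sum>m<n. if m = l then (if i = k then Y $$ (m, j) else 0) else 0)"
    using assms by (intro sum.cong) auto
  ultimately show ?thesis
    using assms by (simp add: ad_index[where n = n])
qed

text \<open>Expand \<open>X Y E - X E Y - Y E X + E Y X\<close> for E = E_kl: a factor E on the
  right keeps one column, on the left one row, and in the middle it splits the entry into a
  product.\<close>

lemma ad_ad_unit_E_index:
  assumes "X \<in> carrier_mat n n" "Y \<in> carrier_mat n n" "k < n" "l < n" "i < n" "j < n"
  shows "ad X (ad Y (unit_E n (k, l))) $$ (i, j) =
    (if j = l then \<Sum>m<n. X $$ (i, m) * Y $$ (m, k) else 0)
    - X $$ (i, k) * Y $$ (l, j) - Y $$ (i, k) * X $$ (l, j)
    + (if i = k then \<Sum>m<n. Y $$ (l, m) * X $$ (m, j) else 0)"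
proof -
  have "(\<Sum>m<n. X $$ (i, m) * ad Y (unit_E n (k, l)) $$ (m, j)) =
      (\<Sum>m<n. (if j = l then X $$ (i, m) * Y $$ (m, k) else 0)
         - (if m = k then X $$ (i, m) * Y $$ (l, j) else 0))"
    using assms by (intro sum.cong) (auto simp: ad_unit_E_index algebra_simps)
  moreover have "(\<Sum>m<n. ad Y (unit_E n (k, l)) $$ (i, m) * X $$ (m, j)) =
      (\<Sum>m<n. (if m = l then Y $$ (i, k) * X $$ (m, j) else 0)
         - (if i = k then Y $$ (l, m) * X $$ (m, j) else 0))"
    using assms by (intro sum.cong) (auto simp: ad_unit_E_index algebra_simps)
  ultimately show ?thesis
    using assms by (simp add: ad_index[where n = n] sum_subtractf)
qed

section \<open>Sums over all roots and over positive roots\<close>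

abbreviation offdiag :: "nat \<Rightarrow> (nat \<times> nat) set" where
  "offdiag n \<equiv> {(i, j). i < n \<and> j < n \<and> i \<noteq> j}"

lemma finite_offdiag [simp]: "finite (offdiag n)"
  by (rule finite_subset[of _ "{..<n} \<times> {..<n}"]) auto

lemma finite_pos_roots [simp]: "finite (pos_roots n)"
  by (rule finite_subset[of _ "{..<n} \<times> {..<n}"]) (auto simp: pos_roots_def)

lemma sum_square_offdiag:
  fixes g :: "nat \<Rightarrow> nat \<Rightarrow> 'a::comm_monoid_add"
  shows "(\<Sum>i<n. \<Sum>j<n. g i j) = (\<Sum>(i, j)\<in>offdiag n. g i j) + (\<Sum>i<n. g i i)"
proof -
  have "{..<n} \<times> {..<n} = offdiag n \<union> (\<lambda>i. (i, i)) ` {..<n}" by auto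
  then have "(\<Sum>i<n. \<Sum>j<n. g i j) = (\<Sum>(i, j)\<in>offdiag n \<union> (\<lambda>i. (i, i)) ` {..<n}. g i j)"
    by (simp add: sum.cartesian_product)
  also have "\<dots> = (\<Sum>(i, j)\<in>offdiag n. g i j) + (\<Sum>(i, j)\<in>(\<lambda>i. (i, i)) ` {..<n}. g i j)"
    by (intro sum.union_disjoint) auto
  also have "(\<Sum>(i, j)\<in>(\<lambda>i. (i, i)) ` {..<n}. g i j) = (\<Sum>i<n. g i i)"
    by (subst sum.reindex) (auto simp: inj_on_def)
  finally show ?thesis .
qed

text \<open>Each positive root is grouped with its negative. This turns the sum in
  \<open>spin_lift\<close>, and counts of ordered index pairs, into sums over positive
  roots.\<close>

lemma sum_offdiag_pos_roots:
  fixes g :: "nat \<Rightarrow> nat \<Rightarrow> 'a::comm_monoid_add"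
  shows "(\<Sum>(i, j)\<in>offdiag n. g i j) = (\<Sum>(i, j)\<in>pos_roots n. g i j + g j i)"
proof -
  have "offdiag n = pos_roots n \<union> prod.swap ` pos_roots n"
    by (auto simp: pos_roots_def image_iff)
  then have "(\<Sum>(i, j)\<in>offdiag n. g i j) = (\<Sum>(i, j)\<in>pos_roots n \<union> prod.swap ` pos_roots n. g i j)"
    by simp
  also have "\<dots> = (\<Sum>(i, j)\<in>pos_roots n. g i j) + (\<Sum>(i, j)\<in>prod.swap ` pos_roots n. g i j)"
    by (intro sum.union_disjoint) (simp, simp, auto simp: pos_roots_def)
  also have "(\<Sum>(i, j)\<in>prod.swap ` pos_roots n. g i j) = (\<Sum>(i, j)\<in>pos_roots n. g j i)"
    by (subst sum.reindex) (auto simp: case_prod_beta intro: inj_onI)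
  finally show ?thesis unfolding case_prod_unfold sum.distrib .
qed

text \<open>The trace of ad X ad Y on sl(n) agrees with its trace over all matrix units. There the
  four terms of \<open>ad_ad_unit_E_index\<close> sum to n tr(XY) + n tr(YX) - 2 tr(X)
  tr(Y).\<close>

lemma killing_eq:
  assumes X: "X \<in> carrier_mat n n" and Y: "Y \<in> carrier_mat n n"
  shows "killing n X Y =
    2 * of_nat n * (\<Sum>i<n. \<Sum>j<n. X $$ (i, j) * Y $$ (j, i)) - 2 * mtrace X * mtrace Y"
proof (cases n)
  case 0
  then show ?thesis using assms by (simp add: killing_def mtrace_def)
next
  case (Suc m)
  define P where "P i = (\<Sum>j<n. X $$ (i, j) * Y $$ (j, i))" for i
  define Q where "Q i = (\<Sum>j<n. Y $$ (i, j) * X $$ (j, i))" for i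
  \<comment> \<open>\<open>F i j\<close> is the diagonal coefficient of ad X ad Y at E_ij. For i <
    m, \<open>- G i\<close> is the (i, i) entry of its value on E_mm, where m = n - 1 is the last
    index.\<close>
  define F where "F i j = P i - X $$ (i, i) * Y $$ (j, j) - Y $$ (i, i) * X $$ (j, j) + Q j" for i j
  define G where "G i = X $$ (i, m) * Y $$ (m, i) + Y $$ (i, m) * X $$ (m, i)" for i
  have "killing n X Y = (\<Sum>(i, j)\<in>offdiag n. F i j) + (\<Sum>i<m. F i i + G i)"
  proof -
    have "(\<Sum>a\<in>offdiag n. ad X (ad Y (unit_E n a)) $$ a) = (\<Sum>(i, j)\<in>offdiag n. F i j)"
      by (intro sum.cong) (auto simp: ad_ad_unit_E_index[OF X Y] F_def P_def Q_def)
    moreover have "ad X (ad Y (unit_E n (i, i) - unit_E n (m, m))) $$ (i, i) = F i i + G i"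
      if "i < m" for i
    proof -
      have c: "ad X (ad Y (unit_E n (m, m))) \<in> carrier_mat n n" using X Y by simp
      have "ad X (ad Y (unit_E n (i, i) - unit_E n (m, m))) $$ (i, i) =
          (ad X (ad Y (unit_E n (i, i))) - ad X (ad Y (unit_E n (m, m)))) $$ (i, i)"
        using X Y by (simp add: ad_minus[where n = n])
      also have "\<dots> = ad X (ad Y (unit_E n (i, i))) $$ (i, i) - ad X (ad Y (unit_E n (m, m))) $$ (i, i)"
        using that Suc carrier_matD[OF c] by (intro index_minus_mat) auto
      finally have "ad X (ad Y (unit_E n (i, i) - unit_E n (m, m))) $$ (i, i) = \<dots>" .
      moreover have "i < n" "m < n" "i \<noteq> m" using that Suc by auto
      ultimately show ?thesis
        by (simp add: ad_ad_unit_E_index[OF X Y] F_def P_def Q_def G_def)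
    qed
    ultimately show ?thesis using Suc by (simp add: killing_def)
  qed
  also have "\<dots> = (\<Sum>(i, j)\<in>offdiag n. F i j) + (\<Sum>i<n. F i i)"
  proof -
    \<comment> \<open>The products X_mm Y_mm cancel in \<open>F m m\<close>, so the corrections
      \<open>G i\<close> supply exactly the diagonal coefficient at E_mm that the basis of sl(n)
      lacks.\<close>
    have "F m m = (\<Sum>i<m. G i)"
      by (simp add: Suc F_def P_def Q_def G_def sum.distrib mult.commute)
    then show ?thesis by (simp add: Suc sum.distrib)
  qed
  also have "\<dots> = (\<Sum>i<n. \<Sum>j<n. F i j)"
    by (simp add: sum_square_offdiag)
  also have "\<dots> = of_nat n * (\<Sum>i<n. P i) + of_nat n * (\<Sum>i<n. Q i) - 2 * mtrace X * mtrace Y"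
  proof -
    have "mtrace X = (\<Sum>i<n. X $$ (i, i))" "mtrace Y = (\<Sum>i<n. Y $$ (i, i))"
      using X Y by (auto simp: mtrace_def)
    then show ?thesis
      by (simp add: F_def sum.distrib sum_subtractf sum_distrib_left[symmetric]
          sum_distrib_right[symmetric] algebra_simps)
  qed
  also have "(\<Sum>i<n. Q i) = (\<Sum>i<n. P i)"
    unfolding P_def Q_def by (subst sum.swap) (simp add: mult.commute)
  finally show ?thesis by (simp add: P_def)
qed

lemma mtrace_unit_E: "i \<noteq> j \<Longrightarrow> mtrace (unit_E n (i, j)) = 0"
  by (auto simp: mtrace_def unit_E_def intro!: sum.neutral)

lemma killing_unit_E:
  assumes "X \<in> carrier_mat n n" "i < n" "j < n" "i \<noteq> j"
  shows "killing n X (unit_E n (i, j)) = 2 * of_nat n * X $$ (j, i)"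
proof -
  have "(\<Sum>k<n. \<Sum>l<n. X $$ (k, l) * unit_E n (i, j) $$ (l, k)) =
      (\<Sum>k<n. \<Sum>l<n. if l = i then (if k = j then X $$ (k, l) else 0) else 0)"
    by (intro sum.cong refl) auto
  also have "\<dots> = X $$ (j, i)" using assms by simp
  finally show ?thesis using assms by (simp add: killing_eq mtrace_unit_E)
qed

lemma clifford_unit_E_pos:
  assumes "i < j" "j < n"
  shows "clifford n (c \<cdot>\<^sub>m unit_E n (i, j)) f = spin_scale c (wedge (i, j) f)"
proof
  fix A
  have "clifford n (c \<cdot>\<^sub>m unit_E n (i, j)) f A =
      (\<Sum>a\<in>pos_roots n. if a = (i, j) then c * wedge a f A else 0)"
    unfolding clifford_def using assms
    by (intro sum.cong refl) (auto simp: pos_roots_def killing_unit_E split: if_splits)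
  then show "clifford n (c \<cdot>\<^sub>m unit_E n (i, j)) f A = spin_scale c (wedge (i, j) f) A"
    using assms by (simp add: spin_scale_def) (simp add: pos_roots_def)
qed

text \<open>The factor 4n is the 2 in \<open>clifford\<close> times the 2n of
  \<open>killing_unit_E\<close>.\<close>

lemma clifford_unit_E_neg:
  assumes "i < j" "j < n"
  shows "clifford n (c \<cdot>\<^sub>m unit_E n (j, i)) f = spin_scale (4 * of_nat n * c) (contract (i, j) f)"
proof
  fix A
  have "clifford n (c \<cdot>\<^sub>m unit_E n (j, i)) f A =
      (\<Sum>a\<in>pos_roots n. if a = (i, j) then 4 * of_nat n * c * contract a f A else 0)"
    unfolding clifford_def using assms
    by (intro sum.cong refl) (auto simp: pos_roots_def killing_unit_E split: if_splits)
  then show "clifford n (c \<cdot>\<^sub>m unit_E n (j, i)) f A = spin_scale (4 * of_nat n * c) (contract (i, j) f) A"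
    using assms by (simp add: spin_scale_def) (simp add: pos_roots_def)
qed

section \<open>The weights of the spin module\<close>

lemma koszul_sign_square: "koszul_sign a A * koszul_sign a A = 1"
  by (simp add: koszul_sign_def flip: power_mult_distrib)

lemma koszul_sign_remove: "koszul_sign a (A - {a}) = koszul_sign a A"
  unfolding koszul_sign_def by (intro arg_cong2[where f = "(^)"] arg_cong[where f = card]) auto

lemma koszul_sign_insert: "koszul_sign a (insert a A) = koszul_sign a A"
  unfolding koszul_sign_def by (intro arg_cong2[where f = "(^)"] arg_cong[where f = card]) auto

text \<open>Both signs count the elements of \<open>A\<close> before \<open>a\<close>, so their
  product is 1 and the composite is \<open>c\<close> times the projection onto the e_A with
  \<open>a\<close> in \<open>A\<close>. In the opposite order the complementary projection
  appears.\<close>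

lemma wedge_contract: "wedge a (spin_scale c (contract a f)) A = (if a \<in> A then c * f A else 0)"
  using koszul_sign_square[of a A]
  by (simp add: wedge_def contract_def spin_scale_def koszul_sign_remove insert_absorb)

lemma contract_wedge: "contract a (spin_scale c (wedge a f)) A = (if a \<in> A then 0 else c * f A)"
  using koszul_sign_square[of a A]
  by (simp add: wedge_def contract_def spin_scale_def koszul_sign_insert)

text \<open>Roots in \<open>A\<close> count positively here, since e_A is the product of their root
  vectors: for \<open>A\<close> inside \<open>pos_roots n\<close> this is mu of the complement of
  \<open>A\<close>. Complementation permutes the subsets, so multiplicities are the same.\<close>

definition spin_weight :: "nat \<Rightarrow> (nat \<times> nat) set \<Rightarrow> complex mat \<Rightarrow> complex" where
  "spin_weight n A H =
     1 / 2 * (\<Sum>a\<in>pos_roots n. (if a \<in> A then 1 else - 1) * (eps (fst a) H - eps (snd a) H))"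

lemma ad_cartan_unit_E:
  assumes "H \<in> cartan n" "i < n" "j < n"
  shows "ad H (unit_E n (i, j)) = (eps i H - eps j H) \<cdot>\<^sub>m unit_E n (i, j)"
proof (rule eq_matI)
  have H: "H \<in> carrier_mat n n" "diagonal_mat H" using assms by (auto simp: cartan_def sl_def)
  fix k l assume "k < dim_row ((eps i H - eps j H) \<cdot>\<^sub>m unit_E n (i, j))"
    "l < dim_col ((eps i H - eps j H) \<cdot>\<^sub>m unit_E n (i, j))"
  then have "k < n" "l < n" by (auto simp: unit_E_def)
  then show "ad H (unit_E n (i, j)) $$ (k, l) = ((eps i H - eps j H) \<cdot>\<^sub>m unit_E n (i, j)) $$ (k, l)"
    using H assms by (auto simp: ad_unit_E_index eps_def diagonal_mat_def)
qed (use assms in \<open>auto simp: ad_def unit_E_def cartan_def sl_def\<close>)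

text \<open>The dual vector of E_ij is E_ji / 2n. For i < j the summands of (i, j) and (j, i) are
  therefore 4n / 2n = 2 times eps i - eps j on the sets containing (i, j), and -2 times it on the
  others. The prefactor 1/4 leaves the half-sum \<open>spin_weight\<close>.\<close>

lemma spin_lift_cartan:
  assumes "H \<in> cartan n"
  shows "spin_lift n (ad H) f = (\<lambda>A. spin_weight n A H * f A)"
proof
  fix A
  define h where "h i j = clifford n (ad H (unit_E n (i, j)))
    (clifford n ((1 / killing n (unit_E n (i, j)) (unit_E n (j, i))) \<cdot>\<^sub>m unit_E n (j, i)) f) A" for i j
  have "h i j + h j i = 2 * ((if (i, j) \<in> A then 1 else - 1) * (eps i H - eps j H) * f A)"
    if "i < j" "j < n" for i j
  proof -
    have "i < n" using that by simp
    have "h i j = 2 * (eps i H - eps j H) * (if (i, j) \<in> A then f A else 0)"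
      using that \<open>i < n\<close> assms
      by (simp add: h_def ad_cartan_unit_E killing_unit_E clifford_unit_E_pos clifford_unit_E_neg
          spin_scale_def[of "eps i H - eps j H"] wedge_contract)
    moreover have "h j i = 2 * (eps j H - eps i H) * (if (i, j) \<in> A then 0 else f A)"
      using that \<open>i < n\<close> assms
      by (simp add: h_def ad_cartan_unit_E killing_unit_E clifford_unit_E_pos clifford_unit_E_neg
          spin_scale_def[of "4 * of_nat n * (eps j H - eps i H)"] contract_wedge)
    ultimately show ?thesis
      by (cases "(i, j) \<in> A") (simp_all add: right_diff_distrib left_diff_distrib)
  qed
  then have "(\<Sum>(i, j)\<in>pos_roots n. h i j + h j i) = (\<Sum>(i, j)\<in>pos_roots n.
      2 * ((if (i, j) \<in> A then 1 else - 1) * (eps i H - eps j H) * f A))"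
    by (intro sum.cong) (auto simp: pos_roots_def)
  then have "spin_lift n (ad H) f A = 1 / 4 * (\<Sum>(i, j)\<in>pos_roots n.
      2 * ((if (i, j) \<in> A then 1 else - 1) * (eps i H - eps j H) * f A))"
    by (simp add: spin_lift_def h_def[symmetric] sum_offdiag_pos_roots)
  also have "\<dots> = spin_weight n A H * f A"
    by (simp add: spin_weight_def sum_distrib_left sum_distrib_right case_prod_beta mult_ac)
  finally show "spin_lift n (ad H) f A = spin_weight n A H * f A" .
qed

section \<open>Dimensions of weight spaces\<close>

lemma sum_spin_scale_apply: "(\<Sum>i\<in>I. spin_scale (c i) (e i)) A = (\<Sum>i\<in>I. c i * e i A)"
  by (induction I rule: infinite_finite_induct) (auto simp: spin_scale_def)

lemma dim_supported:
  fixes S :: "(nat \<times> nat) set set"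
  assumes "finite S"
  shows "vector_space.dim spin_scale {f. \<forall>A. A \<notin> S \<longrightarrow> f A = 0} = card S"
proof -
  interpret vector_space spin_scale by (rule vector_space_spin_scale)
  let ?W = "{f. \<forall>A. A \<notin> S \<longrightarrow> f A = 0} :: spinor set"
  define e :: "(nat \<times> nat) set \<Rightarrow> spinor" where "e A = (\<lambda>B. if B = A then 1 else 0)" for A
  have inj: "inj_on e S"
    by (auto simp: inj_on_def e_def fun_eq_iff split: if_splits)
  have sub: "subspace ?W"
    by (auto simp: subspace_def spin_scale_def)
  have sum_e: "(\<Sum>A\<in>S. spin_scale (c A) (e A)) B = (if B \<in> S then c B else 0)" for c B
    using assms by (simp add: sum_spin_scale_apply e_def if_distrib cong: if_cong)
  have "independent (e ` S)"
  proof (rule independent_if_scalars_zero)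
    fix c g assume *: "(\<Sum>x\<in>e ` S. spin_scale (c x) x) = 0" "g \<in> e ` S"
    then obtain A where A: "A \<in> S" "g = e A" by auto
    have "(\<Sum>A\<in>S. spin_scale (c (e A)) (e A)) = 0"
      using * by (simp add: sum.reindex[OF inj])
    then show "c g = 0"
      using sum_e[of "\<lambda>A. c (e A)" A] A by simp
  qed (use assms in auto)
  moreover have "e ` S \<subseteq> ?W" by (auto simp: e_def)
  moreover have "?W \<subseteq> span (e ` S)"
  proof
    fix f assume "f \<in> ?W"
    then have "f = (\<Sum>A\<in>S. spin_scale (f A) (e A))"
      by (auto simp: fun_eq_iff sum_e)
    moreover have "\<dots> \<in> span (e ` S)"
      by (intro span_sum span_scale span_base) auto
    ultimately show "f \<in> span (e ` S)" by simp
  qed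
  ultimately show ?thesis
    using dim_unique[of "e ` S" ?W "card S"] card_image[OF inj] by auto
qed

text \<open>The torus acts diagonally, so a weight vector is a function supported on the sets
  \<open>A\<close> of that weight.\<close>

lemma spin_mult_eq_card:
  "spin_mult n \<mu> = card {A. A \<subseteq> pos_roots n \<and> (\<forall>H\<in>cartan n. spin_weight n A H = \<mu> H)}"
    (is "_ = card ?S")
proof -
  have "spin_weight_space n \<mu> = {f. \<forall>A. A \<notin> ?S \<longrightarrow> f A = 0}"
    by (auto simp: spin_weight_space_def spin_space_def spin_lift_cartan spin_scale_def fun_eq_iff)
  moreover have "finite ?S" by (rule finite_subset[of _ "Pow (pos_roots n)"]) auto
  ultimately show ?thesis by (simp only: spin_mult_def dim_supported)
qed

section \<open>Tournaments with given scores\<close>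

text \<open>A pair (i, j) in \<open>R\<close> means that i beats j, so the score of i is the size of
  its image under \<open>R\<close>. Arbitrary vertex sets allow deleting a vertex without
  renumbering the others.\<close>

definition tournaments :: "'a set \<Rightarrow> ('a \<Rightarrow> nat) \<Rightarrow> ('a \<times> 'a) set set" where
  "tournaments V s =
     {R. R \<subseteq> V \<times> V \<and> asym R \<and> total_on V R \<and> (\<forall>i\<in>V. card (R `` {i}) = s i)}"

lemma tournamentsI:
  assumes "R \<subseteq> V \<times> V"
    and "\<And>i j. i \<in> V \<Longrightarrow> j \<in> V \<Longrightarrow> (i, j) \<in> R \<longleftrightarrow> i \<noteq> j \<and> (j, i) \<notin> R"
    and "\<And>i. i \<in> V \<Longrightarrow> card (R `` {i}) = s i"
  shows "R \<in> tournaments V s"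
proof -
  have "asym R"
    by (rule asymI) (use assms(1,2) in blast)
  moreover have "total_on V R"
    by (rule total_onI) (use assms(2) in blast)
  ultimately show ?thesis using assms(1,3) by (simp add: tournaments_def)
qed

lemma tournamentsD:
  assumes "R \<in> tournaments V s"
  shows "R \<subseteq> V \<times> V"
    and "\<And>i j. i \<in> V \<Longrightarrow> j \<in> V \<Longrightarrow> (i, j) \<in> R \<longleftrightarrow> i \<noteq> j \<and> (j, i) \<notin> R"
    and "\<And>i. i \<in> V \<Longrightarrow> card (R `` {i}) = s i"
proof -
  have asym: "asym R" and total: "total_on V R"
    using assms by (simp_all add: tournaments_def)
  show "R \<subseteq> V \<times> V"
    using assms by (simp add: tournaments_def)
  show "card (R `` {i}) = s i" if "i \<in> V" for i
    using assms that by (simp add: tournaments_def)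
  show "(i, j) \<in> R \<longleftrightarrow> i \<noteq> j \<and> (j, i) \<notin> R" if "i \<in> V" "j \<in> V" for i j
    using asymD[OF asym, of i j] asymD[OF asym, of i i] total that
    unfolding total_on_def by metis
qed

lemma finite_tournaments: "finite V \<Longrightarrow> finite (tournaments V s)"
  by (rule finite_subset[of _ "Pow (V \<times> V)"]) (auto simp: tournaments_def)

text \<open>Relabelling the vertices along the bijection is injective on tournaments and carries
  scores along. The reverse inequality comes from the inverse bijection.\<close>

lemma card_tournaments_le:
  assumes "finite V" "bij_betw \<pi> V W" "\<And>i. i \<in> V \<Longrightarrow> s i = t (\<pi> i)"
  shows "card (tournaments V s) \<le> card (tournaments W t)"
proof (rule card_inj_on_le)
  have W: "W = \<pi> ` V" and inj: "inj_on \<pi> V" using assms(2) by (auto simp: bij_betw_def)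
  show "finite (tournaments W t)" using assms(1) W by (simp add: finite_tournaments)
  show "inj_on ((`) (map_prod \<pi> \<pi>)) (tournaments V s)"
    by (rule inj_on_subset[OF inj_on_image_Pow[of _ "V \<times> V"]])
       (use map_prod_inj_on[OF inj inj] in \<open>auto simp: tournaments_def\<close>)
  show "(`) (map_prod \<pi> \<pi>) ` tournaments V s \<subseteq> tournaments W t"
  proof (rule image_subsetI)
    fix R assume R: "R \<in> tournaments V s"
    note RV = tournamentsD(1)[OF R]
    have mem: "(\<pi> i, \<pi> j) \<in> map_prod \<pi> \<pi> ` R \<longleftrightarrow> (i, j) \<in> R" if "i \<in> V" "j \<in> V" for i j
      using inj_on_image_mem_iff[OF map_prod_inj_on[OF inj inj] _ RV, of "(i, j)"] that by simp
    show "map_prod \<pi> \<pi> ` R \<in> tournaments W t"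
    proof (rule tournamentsI)
      show RW: "map_prod \<pi> \<pi> ` R \<subseteq> W \<times> W"
        using RV W by auto
      fix a assume "a \<in> W"
      then obtain i where i: "i \<in> V" "a = \<pi> i" using W by blast
      show "(a, b) \<in> map_prod \<pi> \<pi> ` R \<longleftrightarrow> a \<noteq> b \<and> (b, a) \<notin> map_prod \<pi> \<pi> ` R" if b: "b \<in> W" for b
      proof -
        obtain j where j: "j \<in> V" "b = \<pi> j" using b W by blast
        show ?thesis
          unfolding i(2) j(2) mem[OF i(1) j(1)] mem[OF j(1) i(1)] inj_on_eq_iff[OF inj i(1) j(1)]
          by (rule tournamentsD(2)[OF R i(1) j(1)])
      qed
      have "(map_prod \<pi> \<pi> ` R) `` {a} = \<pi> ` (R `` {i})"
      proof
        show "(map_prod \<pi> \<pi> ` R) `` {a} \<subseteq> \<pi> ` (R `` {i})"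
        proof
          fix b assume b: "b \<in> (map_prod \<pi> \<pi> ` R) `` {a}"
          then obtain j where "j \<in> V" "b = \<pi> j" using RW W by blast
          then show "b \<in> \<pi> ` (R `` {i})" using b mem[OF i(1)] i(2) by simp
        qed
        show "\<pi> ` (R `` {i}) \<subseteq> (map_prod \<pi> \<pi> ` R) `` {a}"
          unfolding i(2) by force
      qed
      moreover have "inj_on \<pi> (R `` {i})"
        using RV by (auto intro: inj_on_subset[OF inj])
      ultimately show "card ((map_prod \<pi> \<pi> ` R) `` {a}) = t a"
        using i tournamentsD(3)[OF R] assms(3) by (simp add: card_image)
    qed
  qed
qed

lemma card_tournaments_cong:
  assumes "finite V" "bij_betw \<pi> V W" "\<And>i. i \<in> V \<Longrightarrow> s i = t (\<pi> i)"
  shows "card (tournaments V s) = card (tournaments W t)"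
proof (rule antisym)
  show "card (tournaments V s) \<le> card (tournaments W t)"
    using assms by (rule card_tournaments_le)
  show "card (tournaments W t) \<le> card (tournaments V s)"
  proof (rule card_tournaments_le)
    show "finite W" using assms bij_betw_finite by blast
    show inv: "bij_betw (inv_into V \<pi>) W V" using assms(2) by (rule bij_betw_inv_into)
    show "t i = s (inv_into V \<pi> i)" if "i \<in> W" for i
      using that assms(3)[of "inv_into V \<pi> i"] bij_betw_inv_into_right[OF assms(2)]
        bij_betwE[OF inv] by auto
  qed
qed

text \<open>The set \<open>B\<close> consists of the vertices that beat \<open>p\<close>; these lose one win when \<open>p\<close> is deleted.\<close>

lemma card_tournaments_delete:
  assumes "finite V" "p \<in> V"
  shows "card (tournaments V s) =
    (\<Sum>B\<in>{B. B \<subseteq> V - {p} \<and> s p + card B = card V - 1 \<and> (\<forall>j\<in>B. 0 < s j)}.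
       card (tournaments (V - {p}) (\<lambda>j. s j - of_bool (j \<in> B))))"
    (is "_ = (\<Sum>B\<in>?Bs. card (?T B))")
proof -
  let ?V = "V - {p}"
  \<comment> \<open>\<open>ext\<close> puts \<open>p\<close> back: the members of \<open>B\<close>
    beat it and it beats all other vertices. Its inverse reads \<open>B\<close> off as the
    predecessors of \<open>p\<close> and restricts the relation.\<close>
  define ext where "ext = (\<lambda>(B, R). R \<union> B \<times> {p} \<union> {p} \<times> (?V - B))"
  have "bij_betw ext (SIGMA B:?Bs. ?T B) (tournaments V s)"
  proof (rule bij_betw_byWitness[where f' = "\<lambda>R. (R\<inverse> `` {p}, R \<inter> ?V \<times> ?V)"])
    have "(ext (B, R))\<inverse> `` {p} = B \<and> ext (B, R) \<inter> ?V \<times> ?V = R"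
      if "B \<subseteq> ?V" "R \<subseteq> ?V \<times> ?V" for B R
      using that by (auto simp: ext_def)
    then show "\<forall>x\<in>SIGMA B:?Bs. ?T B. ((ext x)\<inverse> `` {p}, ext x \<inter> ?V \<times> ?V) = x"
      by (auto dest!: tournamentsD(1))
    show "\<forall>R\<in>tournaments V s. ext (R\<inverse> `` {p}, R \<inter> ?V \<times> ?V) = R"
    proof
      fix R assume R: "R \<in> tournaments V s"
      have "(p, p) \<notin> R" and "\<And>j. j \<in> ?V \<Longrightarrow> (p, j) \<in> R \<longleftrightarrow> (j, p) \<notin> R"
        using tournamentsD(2)[OF R assms(2)] assms(2) by blast+
      then show "ext (R\<inverse> `` {p}, R \<inter> ?V \<times> ?V) = R"
        using tournamentsD(1)[OF R] unfolding ext_def by blast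
    qed
    show "ext ` (SIGMA B:?Bs. ?T B) \<subseteq> tournaments V s"
    proof safe
      fix B R assume B: "B \<subseteq> ?V" "s p + card B = card V - 1" "\<forall>j\<in>B. 0 < s j" and R: "R \<in> ?T B"
      have fB: "finite B" using B assms by (meson finite_Diff finite_subset)
      note RV = tournamentsD(1)[OF R]
      show "ext (B, R) \<in> tournaments V s"
      proof (rule tournamentsI)
        show "ext (B, R) \<subseteq> V \<times> V"
          using RV B(1) assms(2) by (auto simp: ext_def)
        fix i assume i: "i \<in> V"
        show "(i, j) \<in> ext (B, R) \<longleftrightarrow> i \<noteq> j \<and> (j, i) \<notin> ext (B, R)" if "j \<in> V" for j
        proof (cases "i = p \<or> j = p")
          case True
          then show ?thesis using RV B(1) i that by (auto simp: ext_def)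
        next
          case False
          then have "(i, j) \<in> ext (B, R) \<longleftrightarrow> (i, j) \<in> R" "(j, i) \<in> ext (B, R) \<longleftrightarrow> (j, i) \<in> R"
            by (auto simp: ext_def)
          then show ?thesis using tournamentsD(2)[OF R, of i j] i that False by simp
        qed
        show "card (ext (B, R) `` {i}) = s i"
        proof (cases "i = p")
          case True
          then have "ext (B, R) `` {i} = ?V - B" using RV B(1) by (auto simp: ext_def)
          then show ?thesis
            using B assms fB True by (simp add: card_Diff_subset)
        next
          case False
          then have "ext (B, R) `` {i} = R `` {i} \<union> (if i \<in> B then {p} else {})"
            by (auto simp: ext_def)
          moreover have "finite (R `` {i})" "p \<notin> R `` {i}"
            using RV assms(1) by (auto intro: finite_subset[of _ V])
          moreover have "card (R `` {i}) = s i - of_bool (i \<in> B)"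
            using tournamentsD(3)[OF R] False i by simp
          \<comment> \<open>For \<open>i\<close> in \<open>B\<close> the win over \<open>p\<close>
            makes up for the subtracted 1; as \<open>0 < s i\<close>, the subtraction was not
            truncated.\<close>
          ultimately show ?thesis using B(3) by auto
        qed
      qed
    qed
    show "(\<lambda>R. (R\<inverse> `` {p}, R \<inter> ?V \<times> ?V)) ` tournaments V s \<subseteq> (SIGMA B:?Bs. ?T B)"
    proof (rule image_subsetI)
      fix R assume R: "R \<in> tournaments V s"
      let ?B = "R\<inverse> `` {p}"
      note RV = tournamentsD(1)[OF R]
      note iff = tournamentsD(2)[OF R]
      have fin: "finite (R `` {i})" for i
        using RV assms(1) by (auto intro: finite_subset[of _ V])
      have B: "?B \<subseteq> ?V" using RV iff[of p p] by auto
      have "R `` {p} = ?V - ?B" using RV iff[OF assms(2)] assms(2) by blast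
      then have "s p = card (?V - ?B)" using tournamentsD(3)[OF R assms(2)] by simp
      moreover have "card (?V - ?B) + card ?B = card ?V"
        using B assms(1) by (simp add: card_Diff_subset card_mono finite_subset)
      ultimately have 1: "s p + card ?B = card V - 1"
        using assms by simp
      have 2: "0 < s j" if "j \<in> ?B" for j
        using that tournamentsD(3)[OF R, of j] fin[of j] RV card_gt_0_iff[of "R `` {j}"] by auto
      have 3: "R \<inter> ?V \<times> ?V \<in> ?T ?B"
      proof (rule tournamentsI)
        show "R \<inter> ?V \<times> ?V \<subseteq> ?V \<times> ?V" by blast
        show "(i, j) \<in> R \<inter> ?V \<times> ?V \<longleftrightarrow> i \<noteq> j \<and> (j, i) \<notin> R \<inter> ?V \<times> ?V"
          if "i \<in> ?V" "j \<in> ?V" for i j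
          using that iff[of i j] by blast
        fix i assume i: "i \<in> ?V"
        then have "(R \<inter> ?V \<times> ?V) `` {i} = R `` {i} - {p}" using RV by auto
        then show "card ((R \<inter> ?V \<times> ?V) `` {i}) = s i - of_bool (i \<in> ?B)"
          using tournamentsD(3)[OF R, of i] i by (simp add: card_Diff_singleton_if)
      qed
      show "(?B, R \<inter> ?V \<times> ?V) \<in> (SIGMA B:?Bs. ?T B)"
        using B 1 2 3 by simp
    qed
  qed
  then have "card (tournaments V s) = card (SIGMA B:?Bs. ?T B)"
    by (rule bij_betw_same_card[symmetric])
  also have "\<dots> = (\<Sum>B\<in>?Bs. card (?T B))"
    using assms(1) by (intro card_SigmaI) (auto simp: finite_tournaments)
  finally show ?thesis .
qed

section \<open>Multiplicities as numbers of tournaments\<close>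

text \<open>The n * n index pairs consist of the diagonal and two pairs for each positive
  root.\<close>

lemma card_pos_roots: "card (pos_roots n) = n choose 2"
proof -
  have "(\<Sum>i<n. \<Sum>j<n. 1::nat) = (\<Sum>(i, j)\<in>pos_roots n. 1 + 1) + (\<Sum>i<n. 1)"
    unfolding sum_square_offdiag sum_offdiag_pos_roots ..
  then have "2 * card (pos_roots n) = n * (n - 1)"
    by (simp add: case_prod_beta diff_mult_distrib2)
  then show ?thesis by (simp add: choose_two)
qed

text \<open>Roots outside \<open>A\<close> are reversed, so that the first component of a pair is
  always the winner.\<close>

definition tournament_of :: "nat \<Rightarrow> (nat \<times> nat) set \<Rightarrow> (nat \<times> nat) set" where
  "tournament_of n A = A \<union> (pos_roots n - A)\<inverse>"

lemma sum_tournament_of: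
  assumes "A \<subseteq> pos_roots n"
  shows "(\<Sum>a\<in>tournament_of n A. g (fst a)) =
    (\<Sum>a\<in>pos_roots n. g (if a \<in> A then fst a else snd a) :: 'a::comm_monoid_add)"
proof -
  have fin: "finite A" using assms finite_pos_roots finite_subset by blast
  have "(\<Sum>a\<in>tournament_of n A. g (fst a)) =
      (\<Sum>a\<in>A. g (fst a)) + (\<Sum>a\<in>(pos_roots n - A)\<inverse>. g (fst a))"
    unfolding tournament_of_def using assms fin
    by (intro sum.union_disjoint) (simp, simp, auto simp: pos_roots_def)
  also have "(\<Sum>a\<in>(pos_roots n - A)\<inverse>. g (fst a)) = (\<Sum>a\<in>pos_roots n - A. g (snd a))"
    by (rule sum.reindex_bij_witness[of _ prod.swap prod.swap]) auto
  also have "(\<Sum>a\<in>A. g (fst a)) + \<dots> =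
      (\<Sum>a\<in>pos_roots n. g (if a \<in> A then fst a else snd a))"
    unfolding sum.subset_diff[OF assms finite_pos_roots]
    by (subst add.commute) (intro arg_cong2[where f = "(+)"] sum.cong, auto)
  finally show ?thesis .
qed

lemma tournament_of_subset: "A \<subseteq> pos_roots n \<Longrightarrow> tournament_of n A \<subseteq> {..<n} \<times> {..<n}"
  by (auto simp: tournament_of_def pos_roots_def)

text \<open>Group the matches by their winner.\<close>

lemma sum_tournament_of_scores:
  fixes g :: "nat \<Rightarrow> 'a::comm_semiring_1"
  assumes "A \<subseteq> pos_roots n"
  shows "(\<Sum>a\<in>tournament_of n A. g (fst a)) = (\<Sum>i<n. of_nat (card (tournament_of n A `` {i})) * g i)"
proof -
  let ?R = "tournament_of n A"
  have sub: "?R \<subseteq> {..<n} \<times> {..<n}" using assms by (rule tournament_of_subset)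
  have fin: "finite (?R `` {i})" for i
    using sub by (auto intro: finite_subset[of _ "{..<n}"])
  have R: "?R = (SIGMA i:{..<n}. ?R `` {i})" using sub by auto
  have "(\<Sum>a\<in>?R. g (fst a)) = (\<Sum>(i, j)\<in>(SIGMA i:{..<n}. ?R `` {i}). g i)"
    using R by (simp add: case_prod_beta)
  also have "\<dots> = (\<Sum>i<n. \<Sum>j\<in>?R `` {i}. g i)"
    using fin by (subst sum.Sigma) auto
  finally show ?thesis by simp
qed

section \<open>Weights as combinations of the \<open>eps i\<close>\<close>

lemma cartan_sum_eps: "H \<in> cartan n \<Longrightarrow> (\<Sum>i<n. eps i H) = 0"
  by (auto simp: cartan_def sl_def mtrace_def eps_def)

text \<open>Adding half of the sum of all \<open>eps i H + eps j H\<close>, which is a multiple of the trace,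
  turns \<open>1/2 (eps i H - eps j H)\<close> into \<open>eps i H\<close>.\<close>

lemma spin_weight_eq_scores:
  assumes "H \<in> cartan n" "A \<subseteq> pos_roots n"
  shows "spin_weight n A H = (\<Sum>i<n. of_nat (card (tournament_of n A `` {i})) * eps i H)"
proof -
  have "(\<Sum>i<n. \<Sum>j<n. eps i H) = (\<Sum>(i, j)\<in>pos_roots n. eps i H + eps j H) + (\<Sum>i<n. eps i H)"
    unfolding sum_square_offdiag sum_offdiag_pos_roots ..
  moreover have "(\<Sum>i<n. \<Sum>j<n. eps i H) = 0"
    using cartan_sum_eps[OF assms(1)] by (simp flip: sum_distrib_left)
  ultimately have "(\<Sum>a\<in>pos_roots n. eps (fst a) H + eps (snd a) H) = 0"
    using cartan_sum_eps[OF assms(1)] by (simp add: case_prod_beta)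
  then have "spin_weight n A H = 1 / 2 * ((\<Sum>a\<in>pos_roots n.
      (if a \<in> A then 1 else - 1) * (eps (fst a) H - eps (snd a) H)) +
      (\<Sum>a\<in>pos_roots n. eps (fst a) H + eps (snd a) H))"
    by (simp add: spin_weight_def)
  also have "\<dots> = (\<Sum>a\<in>pos_roots n. eps (if a \<in> A then fst a else snd a) H)"
    unfolding sum.distrib[symmetric] sum_distrib_left by (intro sum.cong) auto
  also have "\<dots> = (\<Sum>i<n. of_nat (card (tournament_of n A `` {i})) * eps i H)"
    using sum_tournament_of[OF assms(2), of "\<lambda>i. eps i H"]
      sum_tournament_of_scores[OF assms(2), of "\<lambda>i. eps i H"] by simp
  finally show ?thesis .
qed

lemma abel_summation:
  fixes l x :: "nat \<Rightarrow> 'a::comm_ring"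
  shows "(\<Sum>k\<in>{1..<Suc m}. (l (k - 1) - l k) * (\<Sum>i<k. x i)) =
    (\<Sum>i<m. l i * x i) - l m * (\<Sum>i<m. x i)"
  by (induction m) (auto simp: algebra_simps)

lemma part_weight_eq:
  assumes "H \<in> cartan n"
  shows "part_weight n lam H = (\<Sum>i<n. of_nat (lam ! i) * eps i H)"
proof (cases n)
  case (Suc m)
  \<comment> \<open>Abel summation ends with the last part times minus the sum of the other
    \<open>eps i\<close>; the vanishing trace turns this into the missing last summand.\<close>
  have "(\<Sum>i<m. eps i H) = - eps m H"
    using cartan_sum_eps[OF assms] by (simp add: Suc eq_neg_iff_add_eq_0)
  then show ?thesis
    unfolding part_weight_def fund_weight_def Suc abel_summation[of "\<lambda>k. of_nat (lam ! k)"]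
    by simp
qed (simp add: part_weight_def)

text \<open>On traceless diagonal matrices the \<open>eps i\<close> satisfy only the relation that
  their sum is 0, so the coefficients are determined up to a common constant. Equal coefficient sums
  force that constant to be 0.\<close>

lemma cartan_functionals_eq:
  assumes "\<And>H. H \<in> cartan n \<Longrightarrow> (\<Sum>i<n. a i * eps i H) = (\<Sum>i<n. b i * eps i H)"
    and "(\<Sum>i<n. a i) = (\<Sum>i<n. b i)" and "i < n"
  shows "a i = b i"
proof -
  have *: "a i - b i = a j - b j" if "j < n" "i \<noteq> j" for j
  proof -
    \<comment> \<open>\<open>H\<close> is E_ii - E_jj, which picks out the difference of two
      coefficients.\<close>
    define H where "H = mat n n (\<lambda>(k, l).
      if k = l then (if k = i then 1 else 0) - (if k = j then 1 else 0) else (0::complex))"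
    have "H \<in> cartan n"
      using that assms(3)
      by (auto simp: H_def cartan_def sl_def mtrace_def diagonal_mat_def sum_subtractf)
    moreover have S: "(\<Sum>k<n. c k * eps k H) = c i - c j" for c
    proof -
      have "(\<Sum>k<n. c k * eps k H) = (\<Sum>k<n. (if k = i then c k else 0) - (if k = j then c k else 0))"
        by (intro sum.cong) (auto simp: H_def eps_def)
      then show ?thesis using that assms(3) by (simp add: sum_subtractf)
    qed
    ultimately show ?thesis using assms(1)[of H] S[of a] S[of b] by (simp add: algebra_simps)
  qed
  have "(\<Sum>j<n. a j - b j) = (\<Sum>j<n. a i - b i)"
  proof (rule sum.cong[OF refl])
    fix j assume "j \<in> {..<n}"
    then show "a j - b j = a i - b i" using *[of j] by (cases "i = j") simp_all
  qed
  then show ?thesis using assms(2,3) by (simp add: sum_subtractf)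
qed

text \<open>A tournament is determined by the matches won by the smaller index, and these may be any
  set of positive roots.\<close>

lemma bij_betw_tournament_of:
  "bij_betw (tournament_of n)
     {A. A \<subseteq> pos_roots n \<and> (\<forall>i<n. card (tournament_of n A `` {i}) = s i)} (tournaments {..<n} s)"
proof (rule bij_betw_byWitness[where f' = "\<lambda>R. R \<inter> pos_roots n"])
  let ?S = "{A. A \<subseteq> pos_roots n \<and> (\<forall>i<n. card (tournament_of n A `` {i}) = s i)}"
  show "\<forall>A\<in>?S. tournament_of n A \<inter> pos_roots n = A"
    by (auto simp: tournament_of_def pos_roots_def)
  have inv: "tournament_of n (R \<inter> pos_roots n) = R" if "R \<in> tournaments {..<n} s" for R
  proof (rule Set.set_eqI)
    fix a :: "nat \<times> nat"
    obtain i j where a: "a = (i, j)" by fastforce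
    have "(i, j) \<notin> R" if "\<not> (i < n \<and> j < n)"
      using that tournamentsD(1)[OF \<open>R \<in> _\<close>] by blast
    moreover have "(i, j) \<in> R \<longleftrightarrow> i \<noteq> j \<and> (j, i) \<notin> R" if "i < n" "j < n"
      using that tournamentsD(2)[OF \<open>R \<in> _\<close>, of i j] by simp
    ultimately show "a \<in> tournament_of n (R \<inter> pos_roots n) \<longleftrightarrow> a \<in> R"
      unfolding a tournament_of_def pos_roots_def
      by (cases i j rule: linorder_cases) auto
  qed
  then show "\<forall>R\<in>tournaments {..<n} s. tournament_of n (R \<inter> pos_roots n) = R" by blast
  show "(\<lambda>R. R \<inter> pos_roots n) ` tournaments {..<n} s \<subseteq> ?S"
    using inv by (auto simp: tournamentsD(3))
  show "tournament_of n ` ?S \<subseteq> tournaments {..<n} s"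
  proof (rule image_subsetI)
    fix A assume A: "A \<in> ?S"
    have iff: "(i, j) \<in> tournament_of n A \<longleftrightarrow> i \<noteq> j \<and> (j, i) \<notin> tournament_of n A"
      if "i < n" "j < n" for i j
      using A that unfolding tournament_of_def pos_roots_def
      by (cases i j rule: linorder_cases) auto
    show "tournament_of n A \<in> tournaments {..<n} s"
    proof (rule tournamentsI)
      show "tournament_of n A \<subseteq> {..<n} \<times> {..<n}"
        using A by (simp add: tournament_of_subset)
      show "(i, j) \<in> tournament_of n A \<longleftrightarrow> i \<noteq> j \<and> (j, i) \<notin> tournament_of n A"
        if "i \<in> {..<n}" "j \<in> {..<n}" for i j
        using iff[of i j] that by blast
      show "card (tournament_of n A `` {i}) = s i" if "i \<in> {..<n}" for i
        using A that by simp
    qed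
  qed
qed

lemma N_eq_card_tournaments:
  assumes "length lam = n" "sum_list lam = n choose 2"
  shows "N n lam = card (tournaments {..<n} (\<lambda>i. lam ! i))"
proof -
  have "(\<forall>H\<in>cartan n. spin_weight n A H = part_weight n lam H) \<longleftrightarrow>
      (\<forall>i<n. card (tournament_of n A `` {i}) = lam ! i)" if A: "A \<subseteq> pos_roots n" for A
  proof
    assume *: "\<forall>H\<in>cartan n. spin_weight n A H = part_weight n lam H"
    let ?s = "\<lambda>i. card (tournament_of n A `` {i})"
    \<comment> \<open>Every match has one winner, so the scores add up to the number of positive
      roots. This fixes the constant that the weight alone leaves open.\<close>
    have "(\<Sum>i<n. ?s i) = card (pos_roots n)"
      using sum_tournament_of_scores[OF A, of "\<lambda>_. 1::nat"] sum_tournament_of[OF A, of "\<lambda>_. 1::nat"]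
      by simp
    also have "\<dots> = (\<Sum>i<n. lam ! i)"
      using assms by (simp add: card_pos_roots sum_list_sum_nth atLeast0LessThan)
    finally have sum: "(\<Sum>i<n. of_nat (?s i) :: complex) = (\<Sum>i<n. of_nat (lam ! i))"
      by (simp flip: of_nat_sum)
    have "of_nat (?s i) = (of_nat (lam ! i) :: complex)" if "i < n" for i
      using * by (intro cartan_functionals_eq[OF _ sum that])
        (simp add: spin_weight_eq_scores[OF _ A] part_weight_eq)
    then show "\<forall>i<n. ?s i = lam ! i" by simp
  next
    assume "\<forall>i<n. card (tournament_of n A `` {i}) = lam ! i"
    then show "\<forall>H\<in>cartan n. spin_weight n A H = part_weight n lam H"
      by (simp add: spin_weight_eq_scores[OF _ A] part_weight_eq)
  qed
  then have "N n lam =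
      card {A. A \<subseteq> pos_roots n \<and> (\<forall>i<n. card (tournament_of n A `` {i}) = lam ! i)}"
    unfolding N_def spin_mult_eq_card by (metis (no_types, lifting))
  also have "\<dots> = card (tournaments {..<n} (\<lambda>i. lam ! i))"
    by (rule bij_betw_same_card[OF bij_betw_tournament_of])
  finally show ?thesis .
qed

section \<open>Markings\<close>

text \<open>The 0-based column of the last box in row \<open>j\<close> is
  \<open>lam ! j - 1\<close>. It is a box of the diagram only if the row is nonempty, whence the
  condition \<open>0 < lam ! j\<close> below.\<close>

definition marking_of :: "nat \<Rightarrow> nat list \<Rightarrow> nat set \<Rightarrow> (nat \<times> nat) set" where
  "marking_of p lam B = {p} \<times> {..<lam ! p} \<union> (\<lambda>j. (j, lam ! j - 1)) ` B"

text \<open>Outside row \<open>p\<close> a marking is determined by the rows it meets, and its size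
  is \<open>lam ! p\<close> plus their number. The index set has the form produced by
  \<open>card_tournaments_delete\<close>.\<close>

lemma bij_betw_marking_of:
  assumes "length lam = n" "p < n"
  shows "bij_betw (marking_of p lam)
    {B. B \<subseteq> {..<n} - {p} \<and> lam ! p + card B = card {..<n} - 1 \<and> (\<forall>j\<in>B. 0 < lam ! j)}
    (markings n p lam)" (is "bij_betw _ ?Bs _")
proof (rule bij_betw_byWitness[where f' = "\<lambda>\<beta>. fst ` \<beta> - {p}"])
  have card: "card (marking_of p lam B) = lam ! p + card B" if "B \<subseteq> {..<n} - {p}" for B
  proof -
    have "finite B" using that finite_subset by blast
    then have "card (marking_of p lam B) =
        card ({p} \<times> {..<lam ! p}) + card ((\<lambda>j. (j, lam ! j - 1)) ` B)"
      unfolding marking_of_def using that by (intro card_Un_disjoint) auto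
    then show ?thesis by (simp add: card_image inj_on_def)
  qed
  show "\<forall>B\<in>?Bs. fst ` marking_of p lam B - {p} = B"
    by (auto simp: marking_of_def image_Un image_image)
  have inv: "marking_of p lam (fst ` \<beta> - {p}) = \<beta>" if "\<beta> \<in> markings n p lam" for \<beta>
    using that assms unfolding marking_of_def markings_def diagram_def
    by (fastforce simp: image_iff)
  then show "\<forall>\<beta>\<in>markings n p lam. marking_of p lam (fst ` \<beta> - {p}) = \<beta>" by blast
  show "marking_of p lam ` ?Bs \<subseteq> markings n p lam"
    using assms card by (auto simp: markings_def marking_of_def diagram_def)
  show "(\<lambda>\<beta>. fst ` \<beta> - {p}) ` markings n p lam \<subseteq> ?Bs"
  proof (rule image_subsetI)
    fix \<beta> assume \<beta>: "\<beta> \<in> markings n p lam"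
    then have "fst ` \<beta> - {p} \<subseteq> {..<n} - {p}" "\<forall>j\<in>fst ` \<beta> - {p}. 0 < lam ! j"
      using assms by (auto simp: markings_def diagram_def)
    moreover from this have "lam ! p + card (fst ` \<beta> - {p}) = card {..<n} - 1"
      using card[of "fst ` \<beta> - {p}"] inv[OF \<beta>] \<beta> by (simp add: markings_def)
    ultimately show "fst ` \<beta> - {p} \<in> ?Bs" by simp
  qed
qed

lemma remove_marking_of:
  assumes "B \<subseteq> {..<length lam} - {p}" "\<forall>j\<in>B. 0 < lam ! j"
  shows "remove_marking p lam (marking_of p lam B) =
    rev (sort (map (\<lambda>i. lam ! i - of_bool (i \<in> B)) (filter (\<lambda>i. i \<noteq> p) [0..<length lam])))"
proof -
  have "card {j. (i, j) \<in> diagram lam - marking_of p lam B} = lam ! i - of_bool (i \<in> B)"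
    if "i < length lam" "i \<noteq> p" for i
  proof -
    have "{j. (i, j) \<in> diagram lam - marking_of p lam B} =
        {..<lam ! i} - (if i \<in> B then {lam ! i - 1} else {})"
      using that by (auto simp: diagram_def marking_of_def)
    then show ?thesis using assms by auto
  qed
  then show ?thesis
    unfolding remove_marking_def
    by (intro arg_cong[where f = "\<lambda>xs. rev (sort xs)"] map_cong) auto
qed

text \<open>The shortened rows have the right total for \<open>N_eq_card_tournaments\<close> in rank
  one lower; sorting them and closing the gap at \<open>p\<close> are relabellings of
  vertices.\<close>

lemma N_remove_marking:
  assumes "length lam = n" "sum_list lam = n choose 2" "p < n"
    and B: "B \<subseteq> {..<n} - {p}" "lam ! p + card B = n - 1" "\<forall>j\<in>B. 0 < lam ! j"
  shows "N (n - 1) (remove_marking p lam (marking_of p lam B)) =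
    card (tournaments ({..<n} - {p}) (\<lambda>j. lam ! j - of_bool (j \<in> B)))"
proof -
  define xs where "xs = filter (\<lambda>i. i \<noteq> p) [0..<n]"
  define g where "g = (\<lambda>j. lam ! j - of_bool (j \<in> B))"
  define \<mu> where "\<mu> = rev (sort (map g xs))"
  have \<mu>: "remove_marking p lam (marking_of p lam B) = \<mu>"
    using remove_marking_of[of B lam p] assms by (simp add: \<mu>_def g_def xs_def)
  have xs: "distinct xs" "set xs = {..<n} - {p}" by (auto simp: xs_def)
  then have len: "length xs = n - 1"
    using assms(3) by (simp flip: distinct_card)
  have mset: "mset \<mu> = mset (map g xs)" by (simp add: \<mu>_def)
  have "sum_list \<mu> = (\<Sum>j\<in>{..<n} - {p}. g j)"
    using mset xs by (metis sum_mset_sum_list sum_list_distinct_conv_sum_set)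
  moreover have "(\<Sum>j\<in>{..<n} - {p}. g j) + card B = (\<Sum>j\<in>{..<n} - {p}. lam ! j)"
  proof -
    have "card B = (\<Sum>j\<in>{..<n} - {p}. of_bool (j \<in> B))"
      using B(1) by (simp add: sum.If_cases of_bool_def Int_absorb1 flip: Int_def)
    then have "(\<Sum>j\<in>{..<n} - {p}. g j) + card B = (\<Sum>j\<in>{..<n} - {p}. g j + of_bool (j \<in> B))"
      by (simp add: sum.distrib)
    also have "\<dots> = (\<Sum>j\<in>{..<n} - {p}. lam ! j)"
      using B(3) by (intro sum.cong) (auto simp: g_def)
    finally show ?thesis .
  qed
  moreover have "lam ! p + (\<Sum>j\<in>{..<n} - {p}. lam ! j) = n choose 2"
    using assms by (simp add: sum_list_sum_nth atLeast0LessThan sum.remove[of "{..<n}" p])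
  moreover have "n choose 2 = (n - 1 choose 2) + (n - 1)"
    using assms(3) by (cases n) (simp_all add: numeral_2_eq_2)
  \<comment> \<open>Removing row \<open>p\<close> and one box per element of \<open>B\<close> takes
    away n - 1 boxes, which is the difference of the two binomial coefficients.\<close>
  ultimately have "sum_list \<mu> = n - 1 choose 2"
    using B(2) by linarith
  then have "N (n - 1) \<mu> = card (tournaments {..<n - 1} (\<lambda>i. \<mu> ! i))"
    by (intro N_eq_card_tournaments) (simp_all add: \<mu>_def len)
  also have "\<dots> = card (tournaments {..<n - 1} (\<lambda>i. map g xs ! i))"
  proof -
    obtain \<pi> where "bij_betw \<pi> {..<n - 1} {..<n - 1}" "\<And>i. i < n - 1 \<Longrightarrow> \<mu> ! i = map g xs ! \<pi> i"
      using permutation_Ex_bij[OF mset] by (auto simp: \<mu>_def len)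
    then show ?thesis by (intro card_tournaments_cong[of _ \<pi>]) auto
  qed
  \<comment> \<open>The list \<open>xs\<close> enumerates the vertices other than \<open>p\<close>,
    so indexing into it is the required bijection.\<close>
  also have "\<dots> = card (tournaments ({..<n} - {p}) g)"
    using xs len by (intro card_tournaments_cong[of _ "(!) xs"] bij_betw_nth) auto
  finally show ?thesis by (simp add: \<mu> g_def)
qed

section \<open>The recursion for the multiplicities\<close>

theorem theoremB:
  fixes n p :: nat and lam :: "nat list"
  assumes "n \<ge> 1"
    and "lam \<in> Part (n choose 2) n"
    and "p < n"
  shows "spin_mult n (part_weight n lam) = N n lam
    \<and> N n lam = (\<Sum>\<beta>\<in>markings n p lam. N (n - 1) (remove_marking p lam \<beta>))
    \<and> (\<Sum>\<beta>\<in>markings n p lam. N (n - 1) (remove_marking p lam \<beta>))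
      = (\<Sum>\<beta>\<in>markings n p lam.
           spin_mult (n - 1) (part_weight (n - 1) (remove_marking p lam \<beta>)))"
proof -
  have lam: "length lam = n" "sum_list lam = n choose 2"
    using assms(2) by (auto simp: Part_def)
  let ?Bs = "{B. B \<subseteq> {..<n} - {p} \<and> lam ! p + card B = card {..<n} - 1 \<and> (\<forall>j\<in>B. 0 < lam ! j)}"
  have "N n lam = card (tournaments {..<n} (\<lambda>i. lam ! i))"
    using lam by (rule N_eq_card_tournaments)
  also have "\<dots> = (\<Sum>B\<in>?Bs. card (tournaments ({..<n} - {p}) (\<lambda>j. lam ! j - of_bool (j \<in> B))))"
    using assms(3) by (intro card_tournaments_delete) auto
  also have "\<dots> = (\<Sum>B\<in>?Bs. N (n - 1) (remove_marking p lam (marking_of p lam B)))"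
    using lam assms(3) by (intro sum.cong refl N_remove_marking[symmetric]) auto
  also have "\<dots> = (\<Sum>\<beta>\<in>markings n p lam. N (n - 1) (remove_marking p lam \<beta>))"
    by (rule sum.reindex_bij_betw[OF bij_betw_marking_of[OF lam(1) assms(3)]])
  finally show ?thesis by (simp add: N_def)
qed

end
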